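(* Let $G$ be a topological group with identity element $e$. Then every unit $u$ of the topological quandle $Core(G)$ is a $2$-torsion element of the group $G$, i.e. $u^2=e$. In particular, if $G$ is torsion free, then the set of units $\mathcal{U}_{Core(G)}$ is empty.
   Context: $Core(G)$ is the topological quandle with underlying space $G$ and operation $x\triangleleft y=yx^{-1}y$. For a topological rack or quandle $X$ (a set with a topology and a continuous binary operation $\triangleleft$, satisfying the rack axioms), an element $u\in X$ is a stabiliser if $x\triangleleft u=x$ for all $x\in X$; it is totally fixed if $u\triangleleft x=u$ for all $x\in X$; it is a unit if it is both a stabiliser and totally fixed. $\mathcal{U}_X$ denotes the set of all units of $X$.
   Formalization: The claim that the set of units is empty for torsion free G is stated only for G other than the trivial group: the trivial group is torsion free, yet its identity e is a unit of Core(G). *)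

theory Defs
  imports "HOL-Analysis.Analysis" "HOL-Algebra.Group"
begin

text \<open>The library class \<open>topological_group_add\<close> covers only additively written groups whose
  elements exhaust a type. Here the group is a multiplicative one with an explicit carrier.\<close>

locale topological_group = group G for G (structure) +
  fixes T :: "'a topology"
  assumes topspace_eq: "topspace T = carrier G"
    and continuous_mult: "continuous_map (prod_topology T T) T (\<lambda>(x, y). x \<otimes> y)"
    and continuous_inv: "continuous_map T T (\<lambda>x. inv x)"

definition torsion_free :: "('a, 'b) monoid_scheme \<Rightarrow> bool" where
  "torsion_free G \<longleftrightarrow>
    (\<forall>x \<in> carrier G. \<forall>n::nat. n > 0 \<longrightarrow> x [^]\<^bsub>G\<^esub> n = \<one>\<^bsub>G\<^esub> \<longrightarrow> x = \<one>\<^bsub>G\<^esub>)"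

text \<open>The underlying set of such a structure is the \<open>topspace\<close> of its topology.\<close>

record 'a top_binary =
  top_of :: "'a topology"
  act :: "'a \<Rightarrow> 'a \<Rightarrow> 'a" (infixl \<open>\<triangleleft>\<index>\<close> 70)

abbreviation points :: "('a, 'b) top_binary_scheme \<Rightarrow> 'a set" where
  "points X \<equiv> topspace (top_of X)"

text \<open>Right-handed convention: every right translation \<open>x \<mapsto> x \<triangleleft> y\<close> is an automorphism.\<close>

locale topological_rack =
  fixes X (structure)
  assumes continuous_act:
      "continuous_map (prod_topology (top_of X) (top_of X)) (top_of X) (\<lambda>(x, y). x \<triangleleft> y)"
    and bij_right_translation:
      "y \<in> points X \<Longrightarrow> bij_betw (\<lambda>x. x \<triangleleft> y) (points X) (points X)"
    and right_distrib:
      "\<lbrakk>x \<in> points X; y \<in> points X; z \<in> points X\<rbrakk>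
        \<Longrightarrow> (x \<triangleleft> y) \<triangleleft> z = (x \<triangleleft> z) \<triangleleft> (y \<triangleleft> z)"

locale topological_quandle = topological_rack +
  assumes idem: "x \<in> points X \<Longrightarrow> x \<triangleleft> x = x"

definition stabiliser :: "('a, 'b) top_binary_scheme \<Rightarrow> 'a \<Rightarrow> bool" where
  "stabiliser X u \<longleftrightarrow> u \<in> points X \<and> (\<forall>x \<in> points X. x \<triangleleft>\<^bsub>X\<^esub> u = x)"

definition totally_fixed :: "('a, 'b) top_binary_scheme \<Rightarrow> 'a \<Rightarrow> bool" where
  "totally_fixed X u \<longleftrightarrow> u \<in> points X \<and> (\<forall>x \<in> points X. u \<triangleleft>\<^bsub>X\<^esub> x = u)"

definition rack_units :: "('a, 'b) top_binary_scheme \<Rightarrow> 'a set" where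
  "rack_units X = {u. stabiliser X u \<and> totally_fixed X u}"

definition Core :: "('a, 'b) monoid_scheme \<Rightarrow> 'a topology \<Rightarrow> 'a top_binary" where
  "Core G T = \<lparr>top_of = T, act = (\<lambda>x y. y \<otimes>\<^bsub>G\<^esub> inv\<^bsub>G\<^esub> x \<otimes>\<^bsub>G\<^esub> y)\<rparr>"

context topological_group
begin

lemma Core_invol:
  assumes "x \<in> carrier G" "y \<in> carrier G"
  shows "y \<otimes> inv (y \<otimes> inv x \<otimes> y) \<otimes> y = x"
  using assms by (simp add: inv_mult_group m_assoc) (simp add: m_assoc [symmetric])

lemma Core_distrib:
  assumes "x \<in> carrier G" "y \<in> carrier G" "z \<in> carrier G"
  shows "z \<otimes> inv (y \<otimes> inv x \<otimes> y) \<otimes> z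
    = (z \<otimes> inv y \<otimes> z) \<otimes> inv (z \<otimes> inv x \<otimes> z) \<otimes> (z \<otimes> inv y \<otimes> z)"
proof -
  have c: "a \<otimes> (inv a \<otimes> b) = b" "inv a \<otimes> (a \<otimes> b) = b"
    if "a \<in> carrier G" "b \<in> carrier G" for a b
    using that by (simp_all add: m_assoc [symmetric])
  show ?thesis
    using assms by (simp add: inv_mult_group m_assoc c)
qed

lemma topological_quandle_Core: "topological_quandle (Core G T)"
proof
  have f: "continuous_map (prod_topology T T) T (\<lambda>p. f p \<otimes> g p)"
    if "continuous_map (prod_topology T T) T f" "continuous_map (prod_topology T T) T g" for f g
    using continuous_map_compose [OF continuous_map_pairedI [OF that] continuous_mult]
    by (simp add: o_def)
  have i: "continuous_map (prod_topology T T) T (\<lambda>p. inv (fst p))"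
    using continuous_map_compose [OF continuous_map_fst continuous_inv] by (simp add: o_def)
  have "continuous_map (prod_topology T T) T (\<lambda>p. snd p \<otimes> inv (fst p) \<otimes> snd p)"
    by (intro f i continuous_map_snd)
  then show "continuous_map (prod_topology (top_of (Core G T)) (top_of (Core G T)))
      (top_of (Core G T)) (\<lambda>(x, y). x \<triangleleft>\<^bsub>Core G T\<^esub> y)"
    by (simp add: Core_def case_prod_unfold)
next
  fix y assume "y \<in> points (Core G T)"
  then show "bij_betw (\<lambda>x. x \<triangleleft>\<^bsub>Core G T\<^esub> y) (points (Core G T)) (points (Core G T))"
    by (intro bij_betwI [where g = "\<lambda>x. x \<triangleleft>\<^bsub>Core G T\<^esub> y"])
       (auto simp: Core_def topspace_eq Core_invol)
next
  fix x y z assume "x \<in> points (Core G T)" "y \<in> points (Core G T)" "z \<in> points (Core G T)"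
  then show "(x \<triangleleft>\<^bsub>Core G T\<^esub> y) \<triangleleft>\<^bsub>Core G T\<^esub> z
      = (x \<triangleleft>\<^bsub>Core G T\<^esub> z) \<triangleleft>\<^bsub>Core G T\<^esub> (y \<triangleleft>\<^bsub>Core G T\<^esub> z)"
    using Core_distrib [of x y z] by (simp add: Core_def topspace_eq)
next
  fix x assume "x \<in> points (Core G T)"
  then show "x \<triangleleft>\<^bsub>Core G T\<^esub> x = x"
    by (simp add: Core_def topspace_eq)
qed

text \<open>The trivial group is vacuously torsion free, yet its core has a unit; emptiness of the set of
  units can therefore only be claimed for nontrivial groups.\<close>

lemma trivial_group_torsion_free_with_unit:
  assumes "carrier G = {\<one>}"
  shows "torsion_free G" and "rack_units (Core G T) = {\<one>}"
  using assms
  by (auto simp: torsion_free_def rack_units_def stabiliser_def totally_fixed_def Core_def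
      topspace_eq)

end

end

theory Submission
  imports Defs
begin

text \<open>The argument rests on the stabiliser condition. If \<open>u\<close> stabilises the core, then
  \<open>u x\<inverse> u = x\<close> for every \<open>x\<close>, and testing this at the identity gives \<open>u\<^sup>2 = e\<close>.

  In a torsion free group this forces \<open>u = e\<close>, and the same identity now reads
  \<open>x\<inverse> = x\<close>: every element is an involution, hence trivial by torsion freeness again. So a
  torsion free group whose core has a unit is the trivial group.\<close>

context topological_group
begin

lemma Core_stabiliserD:
  assumes "stabiliser (Core G T) u"
  shows "u \<in> carrier G" and "x \<in> carrier G \<Longrightarrow> u \<otimes> inv x \<otimes> u = x"
  using assms by (auto simp: stabiliser_def Core_def topspace_eq)

lemma Core_stabiliser_square:
  assumes "stabiliser (Core G T) u"
  shows "u [^] (2::nat) = \<one>"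
  using Core_stabiliserD(1) [OF assms] Core_stabiliserD(2) [OF assms, of \<one>]
  by (simp add: numeral_2_eq_2)

lemma torsion_free_Core_stabiliser_trivial:
  assumes tf: "torsion_free G" and u: "stabiliser (Core G T) u"
  shows "carrier G = {\<one>}"
proof -
  have square_free: "x = \<one>" if "x \<in> carrier G" "x [^] (2::nat) = \<one>" for x
    using tf that unfolding torsion_free_def by (meson zero_less_numeral)
  have u_one: "u = \<one>"
    using square_free Core_stabiliserD(1) [OF u] Core_stabiliser_square [OF u] by blast
  have "x = \<one>" if x: "x \<in> carrier G" for x
  proof (rule square_free [OF x])
    have "inv x = x"
      using Core_stabiliserD(2) [OF u x] x u_one by simp
    then show "x [^] (2::nat) = \<one>"
      using r_inv [OF x] x by (simp add: numeral_2_eq_2)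
  qed
  then show ?thesis by auto
qed

end

theorem proposition2p17:
  fixes G (structure) and T :: "'a topology"
  assumes "topological_group G T"
  shows "(\<forall>u \<in> rack_units (Core G T). u [^] (2::nat) = \<one>) \<and>
    (torsion_free G \<and> carrier G \<noteq> {\<one>} \<longrightarrow> rack_units (Core G T) = {})"
  using topological_group.Core_stabiliser_square [OF assms]
    topological_group.torsion_free_Core_stabiliser_trivial [OF assms]
  by (auto simp: rack_units_def)

end
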